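(* Let $\pi\in I(321)$ be an involution without fixed points whose plot has no couple of symmetric connections. Then either $\pi$ is simple, or $\pi=12[\alpha_1,\alpha_2]$ with $\alpha_1$ simple.
   Context: A permutation of length $n$ is a bijection of $\{1,\dots,n\}$ in one-line notation. A permutation avoids $321$ if it has no indices $i<j<k$ with $\pi(i)>\pi(j)>\pi(k)$. An involution satisfies $\pi(\pi(i))=i$ for all $i$; $I(321)$ is the set of involutions avoiding $321$. An interval of a permutation of length $n$ is a set of contiguous positions whose image is a set of contiguous integers; a permutation is simple if its only intervals are the empty set, singletons and $[1,n]$. For nonempty $\alpha_1$ of length $a$ and $\alpha_2$ of length $b$, $12[\alpha_1,\alpha_2]$ is the permutation $\alpha_1(1)\cdots\alpha_1(a)\,(a+\alpha_2(1))\cdots(a+\alpha_2(b))$. For an involution $\pi$ without fixed points, write $\pi=(m_1,M_1)\cdots(m_m,M_m)$ with $m_i<M_i$, $m_1<\cdots<m_m$; the plot is the polygonal line joining $(1,\pi(1)),\dots,(n,\pi(n))$ in order; maxima are the points $(m_i,M_i)$ (above $y=x$), minima the points $(M_i,m_i)$ (below $y=x$). Two maxima (resp. minima) are up-connected (resp. down-connected) if they occur at consecutive positions of $\pi$, i.e. are joined by one segment of the plot. A couple of symmetric connections is an up-connection between two maxima together with a down-connection between the two minima that are their mirror images in the line $y=x$. *)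

theory Defs
  imports Main "HOL-Combinatorics.Permutations"
begin

text \<open>A permutation of length \<open>n\<close> is a function \<open>\<pi> :: nat \<Rightarrow> nat\<close> with \<open>\<pi> permutes {1..n}\<close>, so it is
  the identity outside \<open>{1..n}\<close> and two permutations of length \<open>n\<close> are equal as functions
  iff they have the same one-line notation. The length is always passed explicitly.\<close>

definition avoids_321 :: "nat \<Rightarrow> (nat \<Rightarrow> nat) \<Rightarrow> bool" where
  "avoids_321 n \<pi> \<longleftrightarrow>
     \<not> (\<exists>i\<in>{1..n}. \<exists>j\<in>{1..n}. \<exists>k\<in>{1..n}. i < j \<and> j < k \<and> \<pi> i > \<pi> j \<and> \<pi> j > \<pi> k)"

definition involutions_321 :: "nat \<Rightarrow> (nat \<Rightarrow> nat) set" where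
  "involutions_321 n =
     {\<pi>. \<pi> permutes {1..n} \<and> (\<forall>i\<in>{1..n}. \<pi> (\<pi> i) = i) \<and> avoids_321 n \<pi>}"

definition fixed_point_free :: "nat \<Rightarrow> (nat \<Rightarrow> nat) \<Rightarrow> bool" where
  "fixed_point_free n \<pi> \<longleftrightarrow> (\<forall>i\<in>{1..n}. \<pi> i \<noteq> i)"

text \<open>The empty set is contiguous (take \<open>b < a\<close>).\<close>

definition contiguous :: "nat set \<Rightarrow> bool" where
  "contiguous S \<longleftrightarrow> (\<exists>a b. S = {a..b})"

definition perm_interval :: "nat \<Rightarrow> (nat \<Rightarrow> nat) \<Rightarrow> nat set \<Rightarrow> bool" where
  "perm_interval n \<pi> S \<longleftrightarrow> S \<subseteq> {1..n} \<and> contiguous S \<and> contiguous (\<pi> ` S)"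

definition simple_perm :: "nat \<Rightarrow> (nat \<Rightarrow> nat) \<Rightarrow> bool" where
  "simple_perm n \<pi> \<longleftrightarrow>
     (\<forall>S. perm_interval n \<pi> S \<longrightarrow> S = {} \<or> (\<exists>x. S = {x}) \<or> S = {1..n})"

text \<open>The permutation \<open>12[\<alpha>\<^sub>1,\<alpha>\<^sub>2]\<close>, where \<open>a\<close> is the length of \<open>\<alpha>\<^sub>1\<close>. As \<open>\<alpha>\<^sub>2\<close> is the identity
  beyond its length \<open>b\<close>, this is the identity beyond \<open>a + b\<close>, so \<open>b\<close> is not needed.\<close>

definition inflate_12 :: "nat \<Rightarrow> (nat \<Rightarrow> nat) \<Rightarrow> (nat \<Rightarrow> nat) \<Rightarrow> (nat \<Rightarrow> nat)" where
  "inflate_12 a \<alpha>1 \<alpha>2 = (\<lambda>i. if i \<le> a then \<alpha>1 i else a + \<alpha>2 (i - a))"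

definition plot_points :: "nat \<Rightarrow> (nat \<Rightarrow> nat) \<Rightarrow> (nat \<times> nat) set" where
  "plot_points n \<pi> = {(i, \<pi> i) | i. i \<in> {1..n}}"

text \<open>For a fixed-point-free involution with cycles \<open>(m\<^sub>i, M\<^sub>i)\<close>, \<open>m\<^sub>i < M\<^sub>i\<close>, the points of the plot
  above the diagonal are exactly the \<open>(m\<^sub>i, M\<^sub>i)\<close> and those below it the \<open>(M\<^sub>i, m\<^sub>i)\<close>.\<close>

definition maxima :: "nat \<Rightarrow> (nat \<Rightarrow> nat) \<Rightarrow> (nat \<times> nat) set" where
  "maxima n \<pi> = {(x, y) \<in> plot_points n \<pi>. x < y}"

definition minima :: "nat \<Rightarrow> (nat \<Rightarrow> nat) \<Rightarrow> (nat \<times> nat) set" where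
  "minima n \<pi> = {(x, y) \<in> plot_points n \<pi>. y < x}"

definition consecutive_positions :: "nat \<times> nat \<Rightarrow> nat \<times> nat \<Rightarrow> bool" where
  "consecutive_positions p q \<longleftrightarrow> fst q = fst p + 1 \<or> fst p = fst q + 1"

definition up_connected :: "nat \<Rightarrow> (nat \<Rightarrow> nat) \<Rightarrow> nat \<times> nat \<Rightarrow> nat \<times> nat \<Rightarrow> bool" where
  "up_connected n \<pi> p q \<longleftrightarrow> p \<in> maxima n \<pi> \<and> q \<in> maxima n \<pi> \<and> consecutive_positions p q"

definition down_connected :: "nat \<Rightarrow> (nat \<Rightarrow> nat) \<Rightarrow> nat \<times> nat \<Rightarrow> nat \<times> nat \<Rightarrow> bool" where
  "down_connected n \<pi> p q \<longleftrightarrow> p \<in> minima n \<pi> \<and> q \<in> minima n \<pi> \<and> consecutive_positions p q"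

text \<open>\<open>prod.swap\<close> is the reflection in the line \<open>y = x\<close>.\<close>

definition has_symmetric_connections :: "nat \<Rightarrow> (nat \<Rightarrow> nat) \<Rightarrow> bool" where
  "has_symmetric_connections n \<pi> \<longleftrightarrow>
     (\<exists>p q. up_connected n \<pi> p q \<and> down_connected n \<pi> (prod.swap p) (prod.swap q))"

end

theory Submission imports Defs
begin

text \<open>Let \<open>{1..a}\<close> be the shortest nonempty prefix that \<open>\<pi>\<close> maps to itself. Avoiding 321 forces every
  nonempty contiguous \<open>\<pi>\<close>-invariant subset of \<open>{1..a}\<close> to be all of \<open>{1..a}\<close>. For an interval
  \<open>S\<close> in \<open>{1..a}\<close> the set \<open>S \<inter> \<pi> ` S\<close> is contiguous and invariant, so either \<open>S = {1..a}\<close> or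
  \<open>S\<close> and \<open>\<pi> ` S\<close> are disjoint. In the latter case one of the two sets consists of positions of
  maxima only; as maxima increase, \<open>\<pi>\<close> is a shift on it, and two adjacent positions in it would
  give a couple of symmetric connections. Hence the prefix carries a simple permutation.\<close>

lemma involutions_321_involution:
  assumes "\<pi> \<in> involutions_321 n"
  shows "\<pi> (\<pi> x) = x"
proof (cases "x \<in> {1..n}")
  case False
  then have "\<pi> x = x"
    using assms by (auto simp: involutions_321_def dest: permutes_not_in)
  then show ?thesis by simp
qed (use assms in \<open>auto simp: involutions_321_def\<close>)

lemma involutions_321_in:
  assumes "\<pi> \<in> involutions_321 n"
  shows "\<pi> x \<in> {1..n} \<longleftrightarrow> x \<in> {1..n}"
  using assms permutes_in_image unfolding involutions_321_def by fastforce

lemma involutions_321_avoids: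
  assumes "\<pi> \<in> involutions_321 n" "i \<in> {1..n}" "k \<in> {1..n}"
    "i < j" "j < k" "\<pi> i > \<pi> j" "\<pi> j > \<pi> k"
  shows False
proof -
  have "j \<in> {1..n}" using assms(2-5) by auto
  then show ?thesis
    using assms unfolding involutions_321_def avoids_321_def by blast
qed

text \<open>If \<open>\<pi> x > \<pi> y\<close>, then the positions \<open>x < y < \<pi> y\<close>
  carry the values \<open>\<pi> x > \<pi> y > y\<close>, a 321. Only the right-hand point has to be
  a maximum.\<close>

lemma maxima_increasing:
  assumes "\<pi> \<in> involutions_321 n" "x \<in> {1..n}" "y \<in> {1..n}" "x < y" "y < \<pi> y"
  shows "\<pi> x < \<pi> y"
proof (rule ccontr)
  assume "\<not> \<pi> x < \<pi> y"
  moreover have "\<pi> x \<noteq> \<pi> y"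
    using involutions_321_involution[OF assms(1)] assms(4) by (metis less_irrefl)
  ultimately have "\<pi> y < \<pi> x" by simp
  moreover have "\<pi> y \<in> {1..n}"
    using assms(1,3) involutions_321_in by blast
  ultimately show False
    using involutions_321_avoids[OF assms(1), of x "\<pi> y" y] assms
      involutions_321_involution[OF assms(1)]
    by simp
qed

text \<open>Reflection in the diagonal turns consecutive values into consecutive positions, so the
  minima opposite two adjacent maxima are adjacent as well.\<close>

lemma has_symmetric_connectionsI:
  assumes "\<pi> \<in> involutions_321 n" "x \<in> {1..n}" "Suc x \<in> {1..n}"
    "x < \<pi> x" "\<pi> (Suc x) = Suc (\<pi> x)"
  shows "has_symmetric_connections n \<pi>"
proof -
  let ?p = "(x, \<pi> x)" and ?q = "(Suc x, \<pi> (Suc x))"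
  note inv = involutions_321_involution[OF assms(1)]
  have "\<pi> x \<in> {1..n}" "\<pi> (Suc x) \<in> {1..n}"
    using assms involutions_321_in by blast+
  moreover have "(\<pi> y, y) \<in> plot_points n \<pi>" if "\<pi> y \<in> {1..n}" for y
    using that inv[of y] unfolding plot_points_def by force
  ultimately have "(\<pi> x, x) \<in> plot_points n \<pi>" "(\<pi> (Suc x), Suc x) \<in> plot_points n \<pi>"
    by blast+
  moreover have "?p \<in> plot_points n \<pi>" "?q \<in> plot_points n \<pi>"
    using assms(2,3) unfolding plot_points_def by blast+
  ultimately have "up_connected n \<pi> ?p ?q"
    "down_connected n \<pi> (prod.swap ?p) (prod.swap ?q)"
    using assms(4,5)
    by (auto simp: up_connected_def down_connected_def maxima_def minima_def
        consecutive_positions_def)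
  then show ?thesis unfolding has_symmetric_connections_def by blast
qed

text \<open>As \<open>j < k\<close>, all points over \<open>{i..j}\<close> are maxima, so
  \<open>\<pi>\<close> increases there. An increasing map onto a contiguous set skips no
  value.\<close>

lemma shift_of_maxima_singleton:
  assumes "\<pi> \<in> involutions_321 n" "\<not> has_symmetric_connections n \<pi>"
    and "{i..j} \<subseteq> {1..n}" "i \<le> j" "\<pi> ` {i..j} = {k..l}" "j < k"
  shows "i = j"
proof (rule ccontr)
  assume "i \<noteq> j"
  then have ij: "i \<in> {i..j}" "Suc i \<in> {i..j}" using assms(4) by auto
  have up: "x \<in> {1..n} \<and> x < \<pi> x \<and> \<pi> x \<in> {k..l}" if "x \<in> {i..j}" for x
  proof -
    have "\<pi> x \<in> {k..l}" using that assms(5) by blast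
    then show ?thesis using that assms(3,6) by auto
  qed
  have less: "\<pi> i < \<pi> (Suc i)"
    using maxima_increasing[OF assms(1), of i "Suc i"] up ij by auto
  have "\<pi> (Suc i) = Suc (\<pi> i)"
  proof (rule ccontr)
    assume "\<pi> (Suc i) \<noteq> Suc (\<pi> i)"
    then have v: "\<pi> i < Suc (\<pi> i)" "Suc (\<pi> i) < \<pi> (Suc i)" using less by auto
    then have "Suc (\<pi> i) \<in> {k..l}" using up[OF ij(1)] up[OF ij(2)] by auto
    \<comment> \<open>A value skipped between \<open>i\<close> and \<open>Suc i\<close> would have
      to be taken at some \<open>w\<close> beyond \<open>Suc i\<close>, where monotonicity makes it
      too large.\<close>
    then obtain w where w: "w \<in> {i..j}" "Suc (\<pi> i) = \<pi> w" using assms(5) by blast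
    then have "w \<noteq> i" "w \<noteq> Suc i" using v by auto
    then have "Suc i < w" using w by auto
    then have "\<pi> (Suc i) < \<pi> w"
      using maxima_increasing[OF assms(1), of "Suc i" w] up ij w by auto
    then show False using v w by simp
  qed
  then show False
    using has_symmetric_connectionsI[OF assms(1), of i] up[OF ij(1)] up[OF ij(2)] assms(2)
    by blast
qed

text \<open>Avoiding 321 makes \<open>{1..p - 1}\<close> invariant too, so minimality of
  \<open>a\<close> forces \<open>p = 1\<close>, and then \<open>q = a\<close>.\<close>

lemma invariant_interval_eq_prefix:
  assumes "\<pi> \<in> involutions_321 n" "a \<le> n"
    and min: "\<And>b. 1 \<le> b \<Longrightarrow> b < a \<Longrightarrow> \<not> \<pi> ` {1..b} \<subseteq> {1..b}"
    and "1 \<le> p" "p \<le> q" "q \<le> a" and invar: "\<pi> ` {p..q} \<subseteq> {p..q}"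
  shows "p = 1 \<and> q = a"
proof -
  note inv = involutions_321_involution[OF assms(1)]
  have pre: "\<pi> x \<in> {1..p - 1}" if "x \<in> {1..p - 1}" for x
  proof (rule ccontr)
    assume "\<pi> x \<notin> {1..p - 1}"
    moreover have x: "x \<in> {1..n}" "\<pi> x \<in> {1..n}"
      using that assms involutions_321_in[OF assms(1), of x] by auto
    ultimately have "p \<le> \<pi> x" by auto
    moreover have "\<pi> x \<notin> {p..q}"
    proof
      assume "\<pi> x \<in> {p..q}"
      then have "\<pi> (\<pi> x) \<in> {p..q}" using invar by blast
      then show False using inv that by auto
    qed
    moreover have "\<pi> p \<in> {p..q}" using invar assms(5) by (simp add: image_subset_iff)
    moreover have "x < p" using that by auto
    \<comment> \<open>Here \<open>\<pi> x > q\<close>, so the positions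
      \<open>x < p < \<pi> x\<close> carry the values \<open>\<pi> x > \<pi> p > x\<close>.\<close>
    ultimately show False
      using involutions_321_avoids[OF assms(1), of x "\<pi> x" p] x inv assms(5) by auto
  qed
  have "p = 1"
  proof (rule ccontr)
    assume "p \<noteq> 1"
    then have "1 \<le> p - 1" "p - 1 < a" using assms(4-6) by auto
    then show False using min[of "p - 1"] pre by blast
  qed
  moreover have "\<not> q < a"
    using min[of q] invar \<open>p = 1\<close> \<open>p \<le> q\<close> by blast
  ultimately show ?thesis using \<open>q \<le> a\<close> by simp
qed

lemma simple_perm_minimal_prefix:
  assumes "\<pi> \<in> involutions_321 n" "\<not> has_symmetric_connections n \<pi>" "a \<le> n"
    and min: "\<And>b. 1 \<le> b \<Longrightarrow> b < a \<Longrightarrow> \<not> \<pi> ` {1..b} \<subseteq> {1..b}"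
    and invar: "\<pi> ` {1..a} \<subseteq> {1..a}"
  shows "simple_perm a \<pi>"
  unfolding simple_perm_def
proof (intro allI impI)
  fix S assume "perm_interval a \<pi> S"
  then obtain i j k l where S: "S \<subseteq> {1..a}" "S = {i..j}" and T: "\<pi> ` S = {k..l}"
    unfolding perm_interval_def contiguous_def by blast
  note inv = involutions_321_involution[OF assms(1)]
  have TS: "\<pi> ` {k..l} = S"
    unfolding T[symmetric] image_image inv by simp
  have Ta: "{k..l} \<subseteq> {1..a}" using S T invar by blast
  show "S = {} \<or> (\<exists>x. S = {x}) \<or> S = {1..a}"
  proof (cases "S = {}")
    case False
    then have ij: "i \<le> j" using S by auto
    have "{k..l} \<noteq> {}" using False T by blast
    then have kl: "k \<le> l" by simp
    \<comment> \<open>Two disjoint nonempty contiguous sets lie entirely on different sides of each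
      other.\<close>
    consider "S \<inter> {k..l} \<noteq> {}" | "j < k" | "l < i"
      using S ij kl by fastforce
    then show ?thesis
    proof cases
      case 1
      let ?p = "max i k" and ?q = "min j l"
      have eq: "S \<inter> {k..l} = {?p..?q}" using S by auto
      have "\<pi> ` (S \<inter> {k..l}) \<subseteq> S \<inter> {k..l}" using T TS by blast
      then have "\<pi> ` {?p..?q} \<subseteq> {?p..?q}" using eq by simp
      moreover have "?p \<le> ?q" using 1 eq by auto
      moreover have "1 \<le> ?p" "?q \<le> a" using S ij by auto
      ultimately have "?p = 1 \<and> ?q = a"
        using invariant_interval_eq_prefix[OF assms(1,3) min] by blast
      then have "{1..a} \<subseteq> S" using eq by auto
      then show ?thesis using S by blast
    next
      case 2
      then have "i = j"
        using shift_of_maxima_singleton[OF assms(1,2), of i j k l] S T ij assms(3) by auto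
      then show ?thesis using S by auto
    next
      case 3
      \<comment> \<open>\<open>\<pi>\<close> carries \<open>{k..l}\<close> back onto
        \<open>S\<close>, so the previous case applies with the two sets exchanged.\<close>
      then have "k = l"
        using shift_of_maxima_singleton[OF assms(1,2), of k l i j] S Ta TS kl assms(3) by auto
      then show ?thesis using TS by auto
    qed
  qed simp
qed

lemma simple_perm_cong:
  assumes "\<And>i. i \<in> {1..n} \<Longrightarrow> f i = g i"
  shows "simple_perm n f \<longleftrightarrow> simple_perm n g"
proof -
  have "f ` S = g ` S" if "S \<subseteq> {1..n}" for S
    using that assms by (intro image_cong) auto
  then show ?thesis unfolding simple_perm_def perm_interval_def by metis
qed

lemma involution_permutes:
  assumes "\<And>x. f (f x) = x" "\<And>x. x \<notin> A \<Longrightarrow> f x = x"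
  shows "f permutes A"
  unfolding permutes_def using assms by metis

lemma involution_inflate_12:
  fixes \<pi> :: "nat \<Rightarrow> nat"
  assumes inv: "\<And>x. \<pi> (\<pi> x) = x" and out: "\<And>x. x \<notin> {1..n} \<Longrightarrow> \<pi> x = x"
    and invar: "\<pi> ` {1..a} \<subseteq> {1..a}" and "a \<le> n"
  obtains \<alpha>1 \<alpha>2 where "\<alpha>1 permutes {1..a}" "\<alpha>2 permutes {1..n - a}"
    "\<pi> = inflate_12 a \<alpha>1 \<alpha>2" "\<And>i. i \<in> {1..a} \<Longrightarrow> \<alpha>1 i = \<pi> i"
proof
  \<comment> \<open>\<open>\<pi>\<close> need not be the identity beyond \<open>a\<close>, so its
    restriction to the prefix is extended by the identity.\<close>
  let ?\<alpha>1 = "\<lambda>i. if i \<le> a then \<pi> i else i"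
  let ?\<alpha>2 = "\<lambda>i. \<pi> (i + a) - a"
  have le: "\<pi> i \<le> a" if "i \<le> a" for i
  proof (cases "i = 0")
    case False
    then show ?thesis using that invar by (auto simp: image_subset_iff)
  qed (use out in simp)
  have ge: "\<pi> i > a" if "i > a" for i
    using le[of "\<pi> i"] inv that by (metis leD leI)
  show "?\<alpha>1 permutes {1..a}"
    using inv le out by (intro involution_permutes) (auto split: if_splits)
  show "?\<alpha>2 permutes {1..n - a}"
  proof (rule involution_permutes)
    show "?\<alpha>2 (?\<alpha>2 x) = x" for x
    \<comment> \<open>At 0 the truncated subtraction gives \<open>\<pi> a - a = 0\<close>, because
      \<open>\<pi> a \<le> a\<close>; for positive \<open>x\<close> the image stays above
      \<open>a\<close> and nothing is truncated.\<close>
    proof (cases "x = 0")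
      case True
      then show ?thesis using le[of a] by simp
    next
      case False
      then show ?thesis using ge[of "x + a"] inv by simp
    qed
    show "?\<alpha>2 x = x" if "x \<notin> {1..n - a}" for x
      using that out[of "x + a"] le[of a] by (cases "x = 0") auto
  qed
  show "\<pi> = inflate_12 a ?\<alpha>1 ?\<alpha>2"
    using ge by (auto simp: inflate_12_def fun_eq_iff less_imp_le)
qed simp

theorem theorem6p3:
  fixes n :: nat and \<pi> :: "nat \<Rightarrow> nat"
  assumes "\<pi> \<in> involutions_321 n"
    and "fixed_point_free n \<pi>"
    and "\<not> has_symmetric_connections n \<pi>"
  shows "simple_perm n \<pi> \<or>
    (\<exists>a b \<alpha>1 \<alpha>2. a \<ge> 1 \<and> b \<ge> 1 \<and> n = a + b \<and> \<alpha>1 permutes {1..a} \<and> \<alpha>2 permutes {1..b} \<and>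
       \<pi> = inflate_12 a \<alpha>1 \<alpha>2 \<and> simple_perm a \<alpha>1)"
proof (cases "n = 0")
  case True
  \<comment> \<open>There is no nonempty prefix to choose; the empty set is the only
    interval.\<close>
  then show ?thesis by (simp add: simple_perm_def perm_interval_def)
next
  case False
  let ?P = "\<lambda>b. 1 \<le> b \<and> \<pi> ` {1..b} \<subseteq> {1..b}"
  define a where "a = (LEAST b. ?P b)"
  have Pn: "?P n" using False involutions_321_in[OF assms(1)] by (auto simp del: atLeastAtMost_iff)
  then have a: "?P a" "a \<le> n"
    unfolding a_def by (rule LeastI, rule Least_le)
  have min: "\<not> \<pi> ` {1..b} \<subseteq> {1..b}" if "1 \<le> b" "b < a" for b
    using not_less_Least[of b ?P] that unfolding a_def by blast
  have simple: "simple_perm a \<pi>"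
    using simple_perm_minimal_prefix[OF assms(1,3) a(2) min] a(1) by blast
  show ?thesis
  \<comment> \<open>If the shortest invariant prefix is everything, \<open>\<pi>\<close> itself is
    simple; otherwise it splits after \<open>a\<close>.\<close>
  proof (cases "a = n")
    case False
    have out: "\<pi> x = x" if "x \<notin> {1..n}" for x
      using assms(1) that by (auto simp: involutions_321_def dest: permutes_not_in)
    obtain \<alpha>1 \<alpha>2 where \<alpha>: "\<alpha>1 permutes {1..a}" "\<alpha>2 permutes {1..n - a}"
      "\<pi> = inflate_12 a \<alpha>1 \<alpha>2" "\<And>i. i \<in> {1..a} \<Longrightarrow> \<alpha>1 i = \<pi> i"
      using involution_inflate_12[OF involutions_321_involution[OF assms(1)] out] a by blast
    have "simple_perm a \<alpha>1" using simple simple_perm_cong[of a \<alpha>1 \<pi>] \<alpha>(4) by blast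
    moreover have "1 \<le> n - a" "n = a + (n - a)" using a False by auto
    ultimately show ?thesis using a(1) \<alpha>(1-3) by blast
  qed (use simple in simp)
qed

end
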